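(* For every integer $m \ge 0$, the limit $R_m(\Omega SU(2)) = \lim_{n\to\infty} R_m(X_n)$ exists and is given by $$R_m(\Omega SU(2)) = \frac{(-1)^m\, S_m\,(1 - e^{w_m\cdot\alpha_1})\,\sum_{n=0}^{\infty} P(n)\, e^{n\delta}}{\prod_{\alpha\in\triangle_{re}^+}(1-e^{\alpha})},$$ where $\triangle_{re}^+$ is the set of positive real roots of the affine Lie algebra $\hat{\mathfrak{sl}}_2$ and $P(n)$ is the number of integer partitions of $n$ (with $P(0)=1$).
   Context: Let $\alpha_0,\alpha_1$ be the simple roots of $\hat{\mathfrak{sl}}_2$ and $\delta=\alpha_0+\alpha_1$. The affine Weyl group $\overline W$ is the infinite dihedral group generated by the involutions $s_0,s_1$, acting linearly on $\mathbb{Z}\alpha_0\oplus\mathbb{Z}\alpha_1$ by $s_i\alpha_i=-\alpha_i$, $s_0\alpha_1=\alpha_1+2\alpha_0$, $s_1\alpha_0=\alpha_0+2\alpha_1$ (so $\delta$ is fixed). Let $W=\{e,s_1\}$. The positive real roots are $\triangle_{re}^+=\{\alpha_1\}\cup\{\pm\alpha_1+n\delta : n\ge 1\}$. For $\beta\in\mathbb{Z}\alpha_0\oplus\mathbb{Z}\alpha_1$ let $e^\beta$ be the corresponding formal exponential, $e^{\beta}e^{\beta'}=e^{\beta+\beta'}$. Put $w_0=e$, $w_1=s_0$, $w_2=s_1s_0$, $w_3=s_0s_1s_0,\dots$: $w_n$ is the alternating word of length $n$ ending (on the right) in $s_0$. These are the minimal length representatives of the cosets $\overline W/W$ and index the $(T\times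 S^1)$-fixed points of $\Omega SU(2)$ (polynomial based loops), which is filtered by the Schubert varieties $X_n=X_{w_n}$. For a reduced word $w=s_{i_1}\cdots s_{i_n}$ define $S_w=\prod_{j=1}^n e^{s_{i_1}\cdots s_{i_{j-1}}(\alpha_{i_j})}$, and put $S_m=S_{w_m}$ ($S_0=1$). For a reduced word $w=s_{i_1}\cdots s_{i_n}$ and $v\in\overline W$ define $$\overline{b_{w,v}}=\sum_{\varepsilon}\ \prod_{j=1}^n\Bigl(1-e^{s_{i_1}^{\varepsilon_1}\cdots s_{i_j}^{\varepsilon_j}\alpha_{i_j}}\Bigr)^{-1},$$ the sum being over all $\varepsilon\in\{0,1\}^n$ with $s_{i_1}^{\varepsilon_1}\cdots s_{i_n}^{\varepsilon_n}=v$. The rational function attached to the fixed point $w_m$ in the localization (Atiyah-Bott type) formula for the Schubert variety $X_n$ is $$R_m(X_n)=\sum_{v'\in w_mW}\overline{b_{w_n,v'}}.$$ The function $R_m(\Omega SU(2))$ appearing in the localization formula for $\Omega SU(2)$ is the limit of $R_m(X_n)$ as $n\to\infty$, where rational functions are expanded as formal power series in $\mathbb{Z}[[e^{\alpha_0},e^{\alpha_1}]]$ (with $(1-e^{-\beta})^{-1}=-e^{\beta}(1-e^{\beta})^{-1}$ for $\beta$ a positive root) and the limit is coefficientwise. *)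

theory Defs
  imports
    Complex_Main
    "HOL-Library.Multiset"
    "HOL-Library.Product_Plus"
    "HOL-Computational_Algebra.Computational_Algebra"
begin

section \<open>Root lattice and affine Weyl group\<close>

text \<open>The pair \<open>(a, b)\<close> stands for \<open>a \<alpha>\<^sub>0 + b \<alpha>\<^sub>1\<close>.\<close>

type_synonym root = "int \<times> int"

datatype idx = I0 | I1

fun simple_root :: "idx \<Rightarrow> root" where
  "simple_root I0 = (1, 0)"
| "simple_root I1 = (0, 1)"

definition root_scale :: "int \<Rightarrow> root \<Rightarrow> root" where
  "root_scale k \<beta> = (k * fst \<beta>, k * snd \<beta>)"

definition null_root :: root where
  "null_root = simple_root I0 + simple_root I1"

definition pos_real_roots :: "root set" where
  "pos_real_roots = {simple_root I1}
     \<union> {simple_root I1 + root_scale (int n) null_root |n. n \<ge> 1}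
     \<union> {- simple_root I1 + root_scale (int n) null_root |n. n \<ge> 1}"

text \<open>The linear maps with \<open>s\<^sub>i \<alpha>\<^sub>i = -\<alpha>\<^sub>i\<close>, \<open>s\<^sub>0 \<alpha>\<^sub>1 = \<alpha>\<^sub>1 + 2 \<alpha>\<^sub>0\<close>, \<open>s\<^sub>1 \<alpha>\<^sub>0 = \<alpha>\<^sub>0 + 2 \<alpha>\<^sub>1\<close>.\<close>

fun simple_refl :: "idx \<Rightarrow> root \<Rightarrow> root" where
  "simple_refl I0 (a, b) = (2 * b - a, b)"
| "simple_refl I1 (a, b) = (a, 2 * a - b)"

lemma simple_refl_involution: "simple_refl i \<circ> simple_refl i = id"
  by (cases i) auto

text \<open>The product of the two involutions has infinite order, so the group of maps they generate
  is the infinite dihedral group. An element of the affine Weyl group is therefore represented by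
  its action on the root lattice, and multiplication is composition.\<close>

lemma simple_refl_product_infinite_order:
  assumes "n > 0"
  shows "(simple_refl I1 \<circ> simple_refl I0) ^^ n \<noteq> id"
proof -
  have "((simple_refl I1 \<circ> simple_refl I0) ^^ n) (0, 1) = (2 * int n, 2 * int n + 1)"
    by (induction n) auto
  with assms show ?thesis by (metis id_apply of_nat_0_less_iff fst_conv
        mult_eq_0_iff zero_neq_numeral less_irrefl)
qed

definition group_prod :: "(root \<Rightarrow> root) list \<Rightarrow> root \<Rightarrow> root" where
  "group_prod gs = foldr (\<circ>) gs id"

definition finite_weyl :: "(root \<Rightarrow> root) set" where
  "finite_weyl = {id, simple_refl I1}"

text \<open>\<open>coset_word n\<close> is the alternating word of length \<open>n\<close> ending on the right in \<open>s\<^sub>0\<close>.\<close>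

fun coset_word :: "nat \<Rightarrow> idx list" where
  "coset_word 0 = []"
| "coset_word (Suc n) = (if even n then I0 else I1) # coset_word n"

definition coset_rep :: "nat \<Rightarrow> root \<Rightarrow> root" where
  "coset_rep n = group_prod (map simple_refl (coset_word n))"

section \<open>Rational functions in the formal exponentials\<close>

text \<open>Rational functions in \<open>e\<^bsup>\<alpha>\<^sub>0\<^esup>\<close> and \<open>e\<^bsup>\<alpha>\<^sub>1\<^esup>\<close>: in \<open>int poly poly\<close> the indeterminate
  of the coefficient ring is \<open>e\<^bsup>\<alpha>\<^sub>0\<^esup>\<close> and the outer one is \<open>e\<^bsup>\<alpha>\<^sub>1\<^esup>\<close>.\<close>

type_synonym ratfun = "int poly poly fract"

definition expo :: "root \<Rightarrow> ratfun" where
  "expo \<beta> = Fract [:[:0, 1:]:] 1 powi fst \<beta> * Fract [:0, 1:] 1 powi snd \<beta>"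

definition S_word :: "idx list \<Rightarrow> ratfun" where
  "S_word is = (\<Prod>j<length is. expo (group_prod (map simple_refl (take j is)) (simple_root (is ! j))))"

definition S_coset :: "nat \<Rightarrow> ratfun" where
  "S_coset m = S_word (coset_word m)"

definition subword :: "idx list \<Rightarrow> nat list \<Rightarrow> (root \<Rightarrow> root) list" where
  "subword is \<epsilon> = map2 (\<lambda>i k. simple_refl i ^^ k) is \<epsilon>"

text \<open>In the factor with 0-based index \<open>j\<close>, the first \<open>j + 1\<close> reflections act, including the one
  for \<open>is ! j\<close> itself.\<close>

definition bbar :: "idx list \<Rightarrow> (root \<Rightarrow> root) \<Rightarrow> ratfun" where
  "bbar is v =
     (\<Sum>\<epsilon> \<in> {\<epsilon>. length \<epsilon> = length is \<and> set \<epsilon> \<subseteq> {0, 1} \<and> group_prod (subword is \<epsilon>) = v}.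
        \<Prod>j<length is.
          inverse (1 - expo (group_prod (take (Suc j) (subword is \<epsilon>)) (simple_root (is ! j)))))"

definition loc_R :: "nat \<Rightarrow> nat \<Rightarrow> ratfun" where
  "loc_R m n = (\<Sum>v \<in> (\<lambda>u. coset_rep m \<circ> u) ` finite_weyl. bbar (coset_word n) v)"

section \<open>Power series in the formal exponentials\<close>

text \<open>As for polynomials, the outer variable is \<open>e\<^bsup>\<alpha>\<^sub>1\<^esup>\<close>.\<close>

type_synonym series = "int fps fps"

definition poly_series :: "int poly poly \<Rightarrow> series" where
  "poly_series p = fps_of_poly (map_poly fps_of_poly p)"

text \<open>A rational function \<open>p/q\<close> expands to the series \<open>f\<close> if \<open>q f = p\<close> holds for series. The
  convention \<open>(1 - e\<^bsup>-\<beta>\<^esup>)\<^sup>-\<^sup>1 = - e\<^bsup>\<beta>\<^esup> (1 - e\<^bsup>\<beta>\<^esup>)\<^sup>-\<^sup>1\<close> for positive \<open>\<beta>\<close> needs no separate clause, being an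
  identity of rational functions.\<close>

definition expands_to :: "ratfun \<Rightarrow> series \<Rightarrow> bool" where
  "expands_to r f \<longleftrightarrow>
     (\<exists>p q. q \<noteq> 0 \<and> r = Fract p q \<and> poly_series q * f = poly_series p)"

definition expansion :: "ratfun \<Rightarrow> series" where
  "expansion r = (THE f. expands_to r f)"

definition coeffwise_tendsto :: "('a \<Rightarrow> series) \<Rightarrow> series \<Rightarrow> 'a filter \<Rightarrow> bool" where
  "coeffwise_tendsto F L net \<longleftrightarrow>
     (\<forall>i j. ((\<lambda>x. fps_nth (fps_nth (F x) j) i) \<longlongrightarrow> fps_nth (fps_nth L j) i) net)"

definition series_infprod :: "('a \<Rightarrow> series) \<Rightarrow> 'a set \<Rightarrow> series" where
  "series_infprod f A =
     (THE L. coeffwise_tendsto (\<lambda>B. \<Prod>a\<in>B. f a) L (finite_subsets_at_top A))"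

definition series_quotient :: "series \<Rightarrow> series \<Rightarrow> series" where
  "series_quotient f g = (THE h. h * g = f)"

definition has_series_limit :: "(nat \<Rightarrow> ratfun) \<Rightarrow> series \<Rightarrow> bool" where
  "has_series_limit r L \<longleftrightarrow>
     (\<exists>F. (\<forall>n. expands_to (r n) (F n)) \<and> coeffwise_tendsto F L sequentially)"

text \<open>Uniqueness of the objects picked out by the definite descriptions above.\<close>

lemma fps_of_poly_series_0: "map_poly fps_of_poly p = 0 \<longleftrightarrow> p = (0 :: int poly poly)"
  by (rule map_poly_eq_0_iff) auto

lemma poly_series_eq_0_iff: "poly_series p = 0 \<longleftrightarrow> p = 0"
  by (simp add: poly_series_def fps_of_poly_series_0)

lemma poly_series_mult: "poly_series (p * q) = poly_series p * poly_series q"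
proof -
  have "map_poly fps_of_poly (p * q) = map_poly fps_of_poly p * map_poly fps_of_poly q"
    by (rule poly_eqI)
      (simp add: coeff_map_poly coeff_mult fps_of_poly_sum fps_of_poly_mult)
  then show ?thesis by (simp add: poly_series_def fps_of_poly_mult)
qed

lemma expands_to_unique:
  assumes "expands_to r f" "expands_to r g"
  shows "f = g"
proof -
  obtain p q where 1: "q \<noteq> 0" "r = Fract p q" "poly_series q * f = poly_series p"
    using assms(1) unfolding expands_to_def by blast
  obtain p' q' where 2: "q' \<noteq> 0" "r = Fract p' q'" "poly_series q' * g = poly_series p'"
    using assms(2) unfolding expands_to_def by blast
  have "p * q' = p' * q" using 1 2 by (simp add: eq_fract)
  then have "poly_series p * poly_series q' = poly_series p' * poly_series q"
    by (metis poly_series_mult)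
  then have "(poly_series q * poly_series q') * f = (poly_series q * poly_series q') * g"
    by (simp add: 1(3)[symmetric] 2(3)[symmetric] ac_simps)
  moreover have "poly_series q * poly_series q' \<noteq> 0"
    using 1(1) 2(1) by (simp add: poly_series_eq_0_iff)
  ultimately show ?thesis by (metis mult_left_cancel)
qed

lemma coeffwise_tendsto_unique:
  assumes "net \<noteq> bot" "coeffwise_tendsto F L net" "coeffwise_tendsto F L' net"
  shows "L = L'"
  using assms unfolding coeffwise_tendsto_def by (intro fps_ext) (blast intro: tendsto_unique)

lemma series_quotient_unique:
  fixes f g h h' :: series
  assumes "g \<noteq> 0" "h * g = f" "h' * g = f"
  shows "h = h'"
  using assms by (metis mult_right_cancel)

section \<open>Partitions\<close>

definition partition_number :: "nat \<Rightarrow> nat" where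
  "partition_number n = card {M :: nat multiset. 0 \<notin># M \<and> sum_mset M = n}"

text \<open>The series \<open>\<Sum>n. P(n) e\<^bsup>n\<delta>\<^esup>\<close>.\<close>

definition partition_series :: series where
  "partition_series =
     Abs_fps (\<lambda>j. Abs_fps (\<lambda>i. if i = j then int (partition_number i) else 0))"

end

theory Submission
  imports Defs
begin

text \<open>
  Label the cosets \<open>w\<^sub>m W\<close> by integers \<open>z\<close>, so that the fixed points of \<open>X\<^sub>n\<close> form an interval
  \<open>[a, b]\<close> with \<open>b - a = n\<close>. Put \<open>q = e\<^bsup>\<delta>\<^esup>\<close>. The function attached to \<open>z\<close> is the Gaussian binomial
  coefficient \<open>(n choose z - a)\<^sub>q\<close> divided by the product of \<open>1 - e\<^bsup>\<beta>\<^esup>\<close> over the weights \<open>\<beta>\<close> of the \<open>n\<close>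
  invariant curves joining \<open>z\<close> to the other fixed points; splitting off the first letter of the
  word turns this into a Pascal rule. The weights are, up to sign, distinct positive real roots
  other than \<open>w\<^sub>m \<alpha>\<^sub>1\<close>, and exactly \<open>m\<close> of them are negative, namely the negatives of the inversions of
  \<open>w\<^sub>m\<close>; rewriting those gives the factor \<open>(-1)\<^sup>m S\<^sub>m\<close>. As \<open>n\<close> grows the weights exhaust the real roots
  and the Gaussian binomial coefficient tends to \<open>\<Prod>(1 - q\<^sup>i)\<^sup>-\<^sup>1\<close>, the generating function of partitions.
\<close>

section \<open>The recursion for the localization coefficients\<close>

text \<open>Replacing \<open>e\<^bsup>\<beta>\<^esup>\<close> by an arbitrary function \<open>h \<beta>\<close> lets a reflection act by
  precomposition on \<open>h\<close>, so that no automorphism of the field of rational functions is needed.\<close>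

definition char_bbar :: "(root \<Rightarrow> 'a::field) \<Rightarrow> idx list \<Rightarrow> (root \<Rightarrow> root) \<Rightarrow> 'a" where
  "char_bbar h is v =
     (\<Sum>\<epsilon> \<in> {\<epsilon>. length \<epsilon> = length is \<and> set \<epsilon> \<subseteq> {0, 1} \<and> group_prod (subword is \<epsilon>) = v}.
        \<Prod>j<length is.
          inverse (1 - h (group_prod (take (Suc j) (subword is \<epsilon>)) (simple_root (is ! j)))))"

lemma bbar_eq_char_bbar: "bbar = char_bbar expo"
  by (intro ext) (simp add: bbar_def char_bbar_def)

lemma group_prod_Nil [simp]: "group_prod [] = id"
  by (simp add: group_prod_def)

lemma group_prod_Cons [simp]: "group_prod (g # gs) = g \<circ> group_prod gs"
  by (simp add: group_prod_def)

lemma subword_Nil [simp]: "subword [] \<epsilon> = []"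
  by (simp add: subword_def)

lemma subword_Cons [simp]: "subword (i # is) (k # \<epsilon>) = (simple_refl i ^^ k) # subword is \<epsilon>"
  by (simp add: subword_def)

lemma simple_refl_simple_refl [simp]: "simple_refl i (simple_refl i x) = x"
  using simple_refl_involution[of i] by (metis comp_apply id_apply)

lemma simple_refl_comp_eq_iff: "simple_refl i \<circ> f = v \<longleftrightarrow> f = simple_refl i \<circ> v"
  by (metis comp_assoc id_comp simple_refl_involution)

lemma simple_refl_comp_comp [simp]: "simple_refl i \<circ> (simple_refl i \<circ> f) = f"
  by (simp add: fun_eq_iff)

lemma simple_refl_simple_root: "simple_refl i (simple_root i) = - simple_root i"
  by (cases i) auto

lemma char_bbar_Nil: "char_bbar h [] v = (if v = id then 1 else 0)"
proof -
  have "{\<epsilon>::nat list. length \<epsilon> = length ([]::idx list) \<and> set \<epsilon> \<subseteq> {0, 1} \<and> group_prod (subword [] \<epsilon>) = v}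
     = (if v = id then {[]} else {})"
    by auto
  then show ?thesis by (simp add: char_bbar_def)
qed

text \<open>Split by the exponent of the first letter. If its reflection acts, the first factor sees
  -\<alpha>_i, while in every later root the leading \<open>simple_refl i\<close> can be moved into
  \<open>h\<close>; the target changes to \<open>simple_refl i \<circ> v\<close> because the
  reflection is an involution.\<close>

lemma char_bbar_Cons:
  "char_bbar h (i # is) v =
     char_bbar h is v / (1 - h (simple_root i))
       + char_bbar (h \<circ> simple_refl i) is (simple_refl i \<circ> v) / (1 - h (- simple_root i))"
proof -
  define T where "T g is \<epsilon> = (\<Prod>j<length is.
          inverse (1 - g (group_prod (take (Suc j) (subword is \<epsilon>)) (simple_root (is ! j)))))"
    for g :: "root \<Rightarrow> 'a" and "is" \<epsilon>
  define E where "E is v = {\<epsilon>::nat list. length \<epsilon> = length is \<and> set \<epsilon> \<subseteq> {0, 1} \<and> group_prod (subword is \<epsilon>) = v}"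
    for "is" v
  have b: "char_bbar g is v = sum (T g is) (E is v)" for g "is" v
    unfolding char_bbar_def T_def E_def ..
  have fin: "finite (E is v)" for "is" v
    by (rule finite_subset[OF _ finite_lists_length_eq[of "{0,1}" "length is"]]) (auto simp: E_def)
  have E: "E (i # is) v = Cons 0 ` E is v \<union> Cons 1 ` E is (simple_refl i \<circ> v)"
  proof (intro equalityI subsetI)
    fix \<epsilon> assume "\<epsilon> \<in> E (i # is) v"
    then obtain k \<epsilon>' where e: "\<epsilon> = k # \<epsilon>'" "k = 0 \<or> k = 1" "length \<epsilon>' = length is" "set \<epsilon>' \<subseteq> {0,1}"
      and g: "(simple_refl i ^^ k) \<circ> group_prod (subword is \<epsilon>') = v"
      by (auto simp: E_def length_Suc_conv)
    from e(2) show "\<epsilon> \<in> Cons 0 ` E is v \<union> Cons 1 ` E is (simple_refl i \<circ> v)"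
      using e(1,3,4) g by (auto simp: E_def simple_refl_comp_eq_iff)
  next
    fix \<epsilon> assume "\<epsilon> \<in> Cons 0 ` E is v \<union> Cons 1 ` E is (simple_refl i \<circ> v)"
    then show "\<epsilon> \<in> E (i # is) v"
      by (auto simp: E_def simple_refl_comp_eq_iff)
  qed
  have T0: "T h (i # is) (0 # \<epsilon>) = inverse (1 - h (simple_root i)) * T h is \<epsilon>" for \<epsilon>
    by (simp add: T_def prod.lessThan_Suc_shift del: prod.lessThan_Suc)
  have T1: "T h (i # is) (1 # \<epsilon>) = inverse (1 - h (- simple_root i)) * T (h \<circ> simple_refl i) is \<epsilon>" for \<epsilon>
    by (simp add: T_def prod.lessThan_Suc_shift simple_refl_simple_root del: prod.lessThan_Suc)
  have "char_bbar h (i # is) v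
      = sum (T h (i # is)) (Cons 0 ` E is v) + sum (T h (i # is)) (Cons 1 ` E is (simple_refl i \<circ> v))"
    unfolding b E by (rule sum.union_disjoint) (auto simp: fin)
  also have "\<dots> = (\<Sum>\<epsilon>\<in>E is v. T h (i # is) (0 # \<epsilon>))
       + (\<Sum>\<epsilon>\<in>E is (simple_refl i \<circ> v). T h (i # is) (1 # \<epsilon>))"
    by (simp add: sum.reindex)
  finally show ?thesis
    by (simp only: T0 T1 b sum_distrib_left[symmetric] divide_inverse) (simp only: mult.commute)
qed

text \<open>For \<open>s = \<plusminus>1\<close> this is the element of the affine Weyl group that fixes \<open>\<delta>\<close> and sends
  \<open>\<alpha>\<^sub>1\<close> to \<open>s (\<alpha>\<^sub>1 - 2 z \<delta>)\<close>; the two signs form one coset of \<open>W\<close>, which is thereby labelled by the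
  integer \<open>z\<close>. On these labels \<open>s\<^sub>0\<close> and \<open>s\<^sub>1\<close> act as \<open>z \<mapsto> 1 - z\<close> and \<open>z \<mapsto> -z\<close>.\<close>

definition weyl_elt :: "int \<Rightarrow> int \<Rightarrow> root \<Rightarrow> root" where
  "weyl_elt s z = (\<lambda>(a, b). (a - 2 * z * s * (b - a), a + s * (1 - 2 * z) * (b - a)))"

fun refl_centre :: "idx \<Rightarrow> int" where
  "refl_centre I0 = 1"
| "refl_centre I1 = 0"

lemma simple_refl_weyl_elt:
  "simple_refl i \<circ> weyl_elt s z = weyl_elt (- s) (refl_centre i - z)"
  by (cases i) (auto simp: weyl_elt_def fun_eq_iff algebra_simps)

lemma weyl_elt_simple_refl: "weyl_elt s z \<circ> simple_refl I1 = weyl_elt (- s) z"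
  by (auto simp: weyl_elt_def fun_eq_iff algebra_simps)

lemma weyl_elt_1_0: "weyl_elt 1 0 = id"
  by (auto simp: weyl_elt_def fun_eq_iff)

lemma weyl_elt_eq_id_iff: "weyl_elt s z = id \<longleftrightarrow> s = 1 \<and> z = 0"
proof
  assume "weyl_elt s z = id"
  then have "weyl_elt s z (0, 1) = (0, 1)" by simp
  then show "s = 1 \<and> z = 0" by (auto simp: weyl_elt_def)
qed (auto simp: weyl_elt_1_0)

section \<open>Sums over one coset and their labels\<close>

definition coset_sum :: "(root \<Rightarrow> 'a::field) \<Rightarrow> idx list \<Rightarrow> int \<Rightarrow> 'a" where
  "coset_sum h is z = char_bbar h is (weyl_elt 1 z) + char_bbar h is (weyl_elt (- 1) z)"

lemma coset_sum_Nil: "coset_sum h [] z = (if z = 0 then 1 else 0)"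
  by (simp add: coset_sum_def char_bbar_Nil weyl_elt_eq_id_iff)

text \<open>A reflection flips the sign \<open>s\<close>, so it merely swaps the two summands of a
  coset; only the label moves.\<close>

lemma coset_sum_Cons:
  "coset_sum h (i # is) z = coset_sum h is z / (1 - h (simple_root i))
     + coset_sum (h \<circ> simple_refl i) is (refl_centre i - z) / (1 - h (- simple_root i))"
  by (simp add: coset_sum_def char_bbar_Cons simple_refl_weyl_elt add_divide_distrib)

text \<open>The sequence 0, 1, -1, 2, -2, ..., obtained from 0 by applying 1 - z and -z in
  turn.\<close>

definition coset_pos :: "nat \<Rightarrow> int" where
  "coset_pos m = (if even m then - int (m div 2) else int (Suc m div 2))"

lemma coset_rep_eq: "coset_rep m = weyl_elt ((- 1) ^ m) (coset_pos m)"
proof (induction m)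
  case 0
  then show ?case by (simp add: coset_rep_def coset_pos_def weyl_elt_1_0)
next
  case (Suc m)
  have "coset_rep (Suc m) = simple_refl (if even m then I0 else I1) \<circ> coset_rep m"
    by (simp add: coset_rep_def)
  also have "\<dots> = weyl_elt (- ((- 1) ^ m)) (refl_centre (if even m then I0 else I1) - coset_pos m)"
    by (simp only: Suc simple_refl_weyl_elt)
  also have "refl_centre (if even m then I0 else I1) - coset_pos m = coset_pos (Suc m)"
    by (auto simp: coset_pos_def elim!: evenE oddE)
  finally show ?case by simp
qed

lemma loc_R_eq: "loc_R m n = coset_sum expo (coset_word n) (coset_pos m)"
proof -
  define s where "s = (- 1 :: int) ^ m"
  have s: "s = 1 \<or> s = - 1" unfolding s_def by (cases "even m") auto
  have "(\<lambda>u. coset_rep m \<circ> u) ` finite_weyl = {weyl_elt s (coset_pos m), weyl_elt (- s) (coset_pos m)}"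
    by (simp add: finite_weyl_def coset_rep_eq weyl_elt_simple_refl s_def)
  \<comment> \<open>\<open>loc_R\<close> sums over the image as a set, so two equal elements would
    be counted once.\<close>
  moreover have ne: "weyl_elt 1 z \<noteq> weyl_elt (- 1) z" for z
  proof
    assume "weyl_elt 1 z = weyl_elt (- 1) z"
    then have "weyl_elt 1 z (0, 1) = weyl_elt (- 1) z (0, 1)" by simp
    then show False by (auto simp: weyl_elt_def)
  qed
  ultimately show ?thesis
    using s by (auto simp: loc_R_def coset_sum_def bbar_eq_char_bbar ne ne[symmetric] add.commute)
qed

section \<open>Closed form for the Schubert varieties\<close>

text \<open>Triviality only at 0 keeps every denominator nonzero and survives precomposition with
  reflections, as the recursion requires.\<close>

definition lattice_char :: "(root \<Rightarrow> 'a::field) \<Rightarrow> bool" where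
  "lattice_char h \<longleftrightarrow> (\<forall>\<beta> \<gamma>. h (\<beta> + \<gamma>) = h \<beta> * h \<gamma>) \<and> (\<forall>\<beta>. h \<beta> = 1 \<longleftrightarrow> \<beta> = 0)"

lemma lattice_char_add: "lattice_char h \<Longrightarrow> h (\<beta> + \<gamma>) = h \<beta> * h \<gamma>"
  unfolding lattice_char_def by blast

lemma lattice_char_eq_1_iff: "lattice_char h \<Longrightarrow> h \<beta> = 1 \<longleftrightarrow> \<beta> = 0"
  unfolding lattice_char_def by blast

lemma lattice_char_uminus:
  assumes "lattice_char h"
  shows "h (- \<beta>) * h \<beta> = 1"
  using lattice_char_add[OF assms, of "- \<beta>" \<beta>] lattice_char_eq_1_iff[OF assms, of 0] by simp

lemma lattice_char_nonzero: "lattice_char h \<Longrightarrow> h \<beta> \<noteq> 0"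
  using lattice_char_uminus[of h \<beta>] by auto

lemma simple_refl_add: "simple_refl i (\<beta> + \<gamma>) = simple_refl i \<beta> + simple_refl i \<gamma>"
  by (cases i; cases \<beta>; cases \<gamma>) auto

lemma simple_refl_eq_0_iff: "simple_refl i \<beta> = 0 \<longleftrightarrow> \<beta> = 0"
  by (cases i; cases \<beta>) (auto simp: zero_prod_def)

lemma lattice_char_simple_refl: "lattice_char h \<Longrightarrow> lattice_char (h \<circ> simple_refl i)"
  unfolding lattice_char_def o_def simple_refl_add by (metis simple_refl_eq_0_iff)

lemma lattice_char_null_multiple:
  assumes "lattice_char h"
  shows "h (int n, int n) = h (1, 1) ^ n"
proof (induction n)
  case 0
  then show ?case using lattice_char_eq_1_iff[OF assms, of 0] by (simp add: zero_prod_def)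
next
  case (Suc n)
  have "h (int (Suc n), int (Suc n)) = h ((1, 1) + (int n, int n))" by simp
  then show ?case using Suc by (simp only: lattice_char_add[OF assms] power_Suc)
qed

text \<open>The q-Pochhammer symbol (q;q)_n, over rings so that q may be a rational function or a
  power series.\<close>

definition qfac :: "'a::comm_ring_1 \<Rightarrow> nat \<Rightarrow> 'a" where
  "qfac q n = (\<Prod>i=1..n. 1 - q ^ i)"

lemma qfac_0 [simp]: "qfac q 0 = 1"
  by (simp add: qfac_def)

lemma qfac_Suc: "qfac q (Suc n) = qfac q n * (1 - q ^ Suc n)"
  by (simp add: qfac_def)

lemma qfac_nonzero:
  assumes "lattice_char h"
  shows "qfac (h (1, 1)) n \<noteq> 0"
proof -
  have "h (1, 1) ^ i \<noteq> 1" if "i \<ge> 1" for i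
    using that lattice_char_eq_1_iff[OF assms, of "(int i, int i)"]
      lattice_char_null_multiple[OF assms, of i] by (auto simp: zero_prod_def)
  then show ?thesis by (auto simp: qfac_def)
qed

text \<open>The weight of the torus-invariant curve joining the fixed points \<open>z\<close> and \<open>z'\<close>: up to sign the
  real root whose reflection exchanges them. At \<open>z' = z\<close> the value is still a root.\<close>

definition curve_weight :: "int \<Rightarrow> int \<Rightarrow> root" where
  "curve_weight z z' = (if z' > z then (z + z', z + z' - 1) else (- (z + z'), 1 - (z + z')))"

text \<open>The interval is arbitrary because the recursion drops either endpoint; the value 0
  outside it covers the boundary cases.\<close>

definition fixed_pt_term :: "(root \<Rightarrow> 'a::field) \<Rightarrow> int \<Rightarrow> int \<Rightarrow> int \<Rightarrow> 'a" where
  "fixed_pt_term h a b z = (if a \<le> z \<and> z \<le> b then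
     qfac (h (1, 1)) (nat (b - a)) /
       (qfac (h (1, 1)) (nat (z - a)) * qfac (h (1, 1)) (nat (b - z))
          * (\<Prod>z'\<in>{a..b} - {z}. 1 - h (curve_weight z z')))
     else 0)"

lemma curve_weight_nonzero: "curve_weight z z' \<noteq> 0"
  by (auto simp: curve_weight_def zero_prod_def)

text \<open>The map c - z reverses the order of the labels, which compensates the sign convention.
  On the diagonal the two sides are negatives of each other, hence the hypothesis.\<close>

lemma simple_refl_curve_weight:
  "z' \<noteq> z \<Longrightarrow> simple_refl i (curve_weight (refl_centre i - z) (refl_centre i - z')) = curve_weight z z'"
  by (cases i) (auto simp: curve_weight_def)

text \<open>Reversing the interval exchanges the two \<open>qfac\<close> factors of the denominator;
  q is unchanged since reflections fix \<delta>.\<close>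

lemma fixed_pt_term_simple_refl:
  fixes i :: idx
  defines "c \<equiv> refl_centre i"
  shows "fixed_pt_term (h \<circ> simple_refl i) a b (c - z) = fixed_pt_term h (c - b) (c - a) z"
proof -
  have d: "(h \<circ> simple_refl i) (1, 1) = h (1, 1)" by (cases i) auto
  have w: "h (simple_refl i (curve_weight (c - z) x)) = h (curve_weight z (c - x))" if "x \<noteq> c - z" for x
    using simple_refl_curve_weight[of "c - x" z i] that by (auto simp: c_def)
  have "(\<Prod>z'\<in>{a..b} - {c - z}. 1 - (h \<circ> simple_refl i) (curve_weight (c - z) z'))
     = (\<Prod>z'\<in>{c - b..c - a} - {z}. 1 - h (curve_weight z z'))"
    by (rule prod.reindex_bij_witness[of _ "\<lambda>x. c - x" "\<lambda>x. c - x"]) (auto simp: w)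
  moreover have "c - a - z = c - z - a" "z - (c - b) = b - (c - z)" "c - a - (c - b) = b - a"
    "(c - b \<le> z \<and> z \<le> c - a) = (a \<le> c - z \<and> c - z \<le> b)"
    by auto
  ultimately show ?thesis
    unfolding fixed_pt_term_def d by (simp only: ac_simps)
qed

text \<open>After clearing denominators this is the identity
  \<open>(1 - u)(1 - q\<^bsup>k+l\<^esup>) = (1 - q\<^sup>l)(1 - u q\<^sup>k) + (1 - q\<^sup>k)(q\<^sup>l - u)\<close>, which combines the two
  Pascal rules for Gaussian binomial coefficients.\<close>

lemma fixed_pt_term_split:
  fixes h :: "root \<Rightarrow> 'a::field"
  assumes h: "lattice_char h" and "a < b"
  defines "\<gamma> \<equiv> (a + b, a + b - 1)"
  shows "fixed_pt_term h a b z =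
    fixed_pt_term h a (b - 1) z / (1 - h \<gamma>) + fixed_pt_term h (a + 1) b z / (1 - h (- \<gamma>))"
proof (cases "a \<le> z \<and> z \<le> b")
  case False
  then show ?thesis by (auto simp: fixed_pt_term_def)
next
  case True
  define q where "q = h (1, 1)"
  define u where "u = h \<gamma>"
  define k where "k = nat (z - a)"
  define l where "l = nat (b - z)"
  define t where "t z' = 1 - h (curve_weight z z')" for z'
  define D where "D = (\<Prod>z'\<in>{a..b} - {z}. t z')"
  have t0: "t z' \<noteq> 0" for z'
    using lattice_char_eq_1_iff[OF h, of "curve_weight z z'"] curve_weight_nonzero by (auto simp: t_def)
  have D0: "D \<noteq> 0" by (simp add: D_def t0)
  have q0: "qfac q n \<noteq> 0" for n using qfac_nonzero[OF h] by (simp add: q_def)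
  have u0: "u \<noteq> 0" using lattice_char_nonzero[OF h] by (simp add: u_def)
  have u1: "u \<noteq> 1" using lattice_char_eq_1_iff[OF h, of \<gamma>] by (auto simp: u_def \<gamma>_def zero_prod_def)
  have hu: "h (- \<gamma>) = inverse u"
    using lattice_char_uminus[OF h, of \<gamma>] u0 by (simp add: u_def field_simps)
  obtain n where n: "k + l = Suc n"
    using True \<open>a < b\<close> by (cases "k + l") (auto simp: k_def l_def)
  have ba: "nat (b - a) = Suc n" "nat (b - 1 - a) = n" "nat (b - (a + 1)) = n"
    using n True \<open>a < b\<close> by (auto simp: k_def l_def)
  have main: "fixed_pt_term h a b z = qfac q (Suc n) / (qfac q k * qfac q l * D)"
    using True by (simp add: fixed_pt_term_def q_def k_def l_def D_def t_def ba)
  \<comment> \<open>The weight towards b is \<gamma> + k\<delta> because z + b = (a + b) + (z - a).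
    At z = b the factor 1 - q^0 vanishes, as it should.\<close>
  have e1: "fixed_pt_term h a (b - 1) z = (1 - q ^ l) * (1 - u * q ^ k) * qfac q n / (qfac q k * qfac q l * D)"
  proof (cases "z = b")
    case True
    then show ?thesis by (simp add: fixed_pt_term_def l_def)
  next
    case False
    then obtain l' where l': "l = Suc l'" using True by (cases l) (auto simp: l_def)
    have "nat (b - 1 - z) = l'" using l' by (simp add: l_def)
    moreover have "{a..b} - {z} = insert b ({a..b - 1} - {z})" using True False by auto
    then have "D = t b * (\<Prod>z'\<in>{a..b - 1} - {z}. t z')" by (simp add: D_def)
    moreover have "t b = 1 - u * q ^ k"
    proof -
      have "curve_weight z b = \<gamma> + (int k, int k)"
        using True False by (auto simp: curve_weight_def \<gamma>_def k_def)
      then show ?thesis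
        by (simp only: t_def lattice_char_add[OF h] lattice_char_null_multiple[OF h] u_def q_def)
    qed
    moreover have "1 - q ^ l \<noteq> 0" using q0[of l] by (auto simp: l' qfac_Suc)
    ultimately show ?thesis
      using True False t0[of b] l' q0
      by (simp add: fixed_pt_term_def ba q_def[symmetric] k_def[symmetric] t_def[symmetric] qfac_Suc
          del: power_Suc)
  qed
  \<comment> \<open>Symmetrically, the weight towards a is -\<gamma> + l\<delta>.\<close>
  have e2: "fixed_pt_term h (a + 1) b z
      = (1 - q ^ k) * (1 - inverse u * q ^ l) * qfac q n / (qfac q k * qfac q l * D)"
  proof (cases "z = a")
    case True
    then show ?thesis by (simp add: fixed_pt_term_def k_def)
  next
    case False
    then obtain k' where k': "k = Suc k'" using True by (cases k) (auto simp: k_def)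
    have "nat (z - (a + 1)) = k'" using k' by (simp add: k_def)
    moreover have "{a..b} - {z} = insert a ({a + 1..b} - {z})" using True False by auto
    then have "D = t a * (\<Prod>z'\<in>{a + 1..b} - {z}. t z')" by (simp add: D_def)
    moreover have "t a = 1 - inverse u * q ^ l"
    proof -
      have "curve_weight z a = - \<gamma> + (int l, int l)"
        using True False by (auto simp: curve_weight_def \<gamma>_def l_def)
      then show ?thesis
        by (simp only: t_def lattice_char_add[OF h] lattice_char_null_multiple[OF h] hu q_def)
    qed
    moreover have "1 - q ^ k \<noteq> 0" using q0[of k] by (auto simp: k' qfac_Suc)
    ultimately show ?thesis
      using True False t0[of a] k' q0
      by (simp add: fixed_pt_term_def ba q_def[symmetric] l_def[symmetric] t_def[symmetric] qfac_Suc
          del: power_Suc)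
  qed
  have e3: "1 - q ^ Suc n = (1 - q ^ l) * (1 - u * q ^ k) / (1 - u)
      + (1 - q ^ k) * (1 - inverse u * q ^ l) / (1 - inverse u)"
  proof -
    \<comment> \<open>Expand the fraction by -u to reach the common denominator 1 - u.\<close>
    have "(1 - q ^ k) * (1 - inverse u * q ^ l) / (1 - inverse u) = (1 - q ^ k) * (q ^ l - u) / (1 - u)"
      using u0 u1 by (simp add: divide_simps) (simp add: algebra_simps)
    moreover have "(1 - q ^ (k + l)) * (1 - u) = (1 - q ^ l) * (1 - u * q ^ k) + (1 - q ^ k) * (q ^ l - u)"
      by (simp add: power_add algebra_simps)
    moreover from this have "1 - q ^ (k + l)
        = ((1 - q ^ l) * (1 - u * q ^ k) + (1 - q ^ k) * (q ^ l - u)) / (1 - u)"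
      using u1 by (simp add: eq_divide_eq)
    ultimately show ?thesis
      by (simp only: n[symmetric] add_divide_distrib)
  qed
  have "Q * (X / p + Y / r) / E = X * Q / E / p + Y * Q / E / r" for Q X Y p r E :: 'a
    by (simp add: add_divide_distrib distrib_left ac_simps)
  then show ?thesis
    unfolding main hu u_def[symmetric] qfac_Suc e1 e2 e3 .
qed

text \<open>The fixed points of \<open>X\<^sub>n\<close> are the labels in \<open>{label_lo n..label_hi n}\<close>.\<close>

definition label_lo :: "nat \<Rightarrow> int" where "label_lo n = - int (n div 2)"
definition label_hi :: "nat \<Rightarrow> int" where "label_hi n = int n - int (n div 2)"

text \<open>The induction keeps \<open>h\<close> arbitrary, as the reflected half evaluates
  \<open>h \<circ> simple_refl i\<close>. The endpoints add up to 1 or 0, so the root \<gamma> of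
  the splitting is \<alpha>_0 or -\<alpha>_1, in accordance with the new first letter.\<close>

lemma coset_sum_coset_word:
  "lattice_char h \<Longrightarrow> coset_sum h (coset_word n) z = fixed_pt_term h (label_lo n) (label_hi n) z"
proof (induction n arbitrary: h z)
  case 0
  then show ?case by (auto simp: coset_sum_Nil fixed_pt_term_def label_lo_def label_hi_def)
next
  case (Suc n)
  note IH = Suc.IH[OF Suc.prems] Suc.IH[OF lattice_char_simple_refl[OF Suc.prems]]
  have lt: "label_lo (Suc n) < label_hi (Suc n)" by (simp add: label_lo_def label_hi_def)
  note split = fixed_pt_term_split[OF Suc.prems lt, of z]
  show ?case
  proof (cases "even n")
    case True
    \<comment> \<open>For s_0 the unreflected half lives on [a, b - 1] and the reflected one on
      [a + 1, b]; for s_1 the two intervals trade places.\<close>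
    then have e: "label_lo n = label_lo (Suc n)" "label_hi n = label_hi (Suc n) - 1"
      and s: "label_lo (Suc n) + label_hi (Suc n) = 1"
      by (auto simp: label_lo_def label_hi_def elim!: evenE)
    have c: "1 - (label_hi (Suc n) - 1) = label_lo (Suc n) + 1" "1 - label_lo (Suc n) = label_hi (Suc n)"
      using s by simp_all
    show ?thesis
      using True split IH fixed_pt_term_simple_refl[of h I0 "label_lo n" "label_hi n" z] unfolding e
      by (simp add: coset_sum_Cons s c o_def)
  next
    case False
    then have e: "label_lo n = label_lo (Suc n) + 1" "label_hi n = label_hi (Suc n)"
      and s: "label_lo (Suc n) + label_hi (Suc n) = 0"
      by (auto simp: label_lo_def label_hi_def elim!: oddE)
    have c: "- label_hi (Suc n) = label_lo (Suc n)" "- label_lo (Suc n) - 1 = label_hi (Suc n) - 1"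
      using s by simp_all
    show ?thesis
      using False split IH fixed_pt_term_simple_refl[of h I1 "label_lo n" "label_hi n" z] unfolding e
      by (simp add: coset_sum_Cons s c o_def)
  qed
qed

section \<open>Clearing the negative roots\<close>

definition char_S :: "(root \<Rightarrow> 'a::field) \<Rightarrow> idx list \<Rightarrow> 'a" where
  "char_S h is = (\<Prod>j<length is. h (group_prod (map simple_refl (take j is)) (simple_root (is ! j))))"

lemma char_S_Cons: "char_S h (i # is) = h (simple_root i) * char_S (h \<circ> simple_refl i) is"
  by (simp add: char_S_def prod.lessThan_Suc_shift del: prod.lessThan_Suc)

text \<open>The positive roots made negative by the inverse of w_m, in the order given by the
  reduced word: \<alpha>_1 + j\<delta> or \<alpha>_0 + j\<delta> for j < m.\<close>

definition inversion_root :: "nat \<Rightarrow> nat \<Rightarrow> root" where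
  "inversion_root m j = (if even m then (int j, int j + 1) else (int j + 1, int j))"

lemma char_S_coset_word: "char_S h (coset_word m) = (\<Prod>j<m. h (inversion_root m j))"
proof (induction m arbitrary: h)
  case 0
  then show ?case by (simp add: char_S_def)
next
  case (Suc m)
  let ?i = "if even m then I0 else I1"
  have "simple_root ?i = inversion_root (Suc m) 0"
    by (simp add: inversion_root_def)
  moreover have "simple_refl ?i (inversion_root m j) = inversion_root (Suc m) (Suc j)" for j
    by (simp add: inversion_root_def)
  ultimately show ?case
    unfolding coset_word.simps char_S_Cons Suc by (simp only: o_def prod.lessThan_Suc_shift)
qed

text \<open>The positive one of the roots \<open>\<plusminus>(\<alpha>\<^sub>1 + k \<delta>)\<close>.\<close>

definition pos_rep :: "int \<Rightarrow> root" where
  "pos_rep k = (if k \<ge> 0 then (k, k + 1) else (- k, - k - 1))"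

text \<open>The root is positive since w_m is shortest in its coset. Its index is -z - z' at z' = z,
  so it fills the gap that z leaves in the product over all labels.\<close>

lemma coset_rep_simple_root: "coset_rep m (simple_root I1) = pos_rep (- 2 * coset_pos m)"
  unfolding coset_rep_eq by (cases "even m") (auto simp: weyl_elt_def coset_pos_def pos_rep_def)

text \<open>Each further letter adds one label, alternately above and below the interval.\<close>

lemma coset_pos_mem: "label_lo n \<le> coset_pos m \<and> coset_pos m \<le> label_hi n \<longleftrightarrow> m \<le> n"
  by (cases "even m"; cases "even n") (auto simp: label_lo_def label_hi_def coset_pos_def elim!: evenE oddE)

text \<open>The labels of w_0, ..., w_{m-1}; the curves from w_m to exactly these have negative
  weight.\<close>

definition neg_points :: "nat \<Rightarrow> int set" where
  "neg_points m = (if even m then {coset_pos m + 1..- coset_pos m}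
     else {1 - coset_pos m..coset_pos m - 1})"

lemma neg_points_subset:
  assumes "m \<le> n"
  shows "neg_points m \<subseteq> {label_lo n..label_hi n} - {coset_pos m}"
  using assms by (cases "even m"; cases "even n")
    (auto simp: neg_points_def label_lo_def label_hi_def coset_pos_def elim!: evenE oddE)

lemma curve_weight_pos_rep:
  assumes "z' \<noteq> coset_pos m"
  shows "curve_weight (coset_pos m) z' =
    (if z' \<in> neg_points m then - pos_rep (- coset_pos m - z') else pos_rep (- coset_pos m - z'))"
  using assms by (cases "even m")
    (auto simp: curve_weight_def pos_rep_def neg_points_def coset_pos_def elim!: evenE oddE)

lemma prod_neg_points:
  fixes h :: "root \<Rightarrow> 'a::field"
  shows "(\<Prod>z'\<in>neg_points m. - h (pos_rep (- coset_pos m - z'))) = (- 1) ^ m * char_S h (coset_word m)"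
proof -
  have "(\<Prod>z'\<in>neg_points m. - h (pos_rep (- coset_pos m - z'))) = (\<Prod>j<m. - h (inversion_root m j))"
  \<comment> \<open>The index \<open>- coset_pos m - z'\<close> has to be j for even m and -(j + 1)
    for odd m; solving for z' gives the witnesses.\<close>
  proof (cases "even m")
    case True
    then show ?thesis
      by (intro prod.reindex_bij_witness[of _ "\<lambda>j. - coset_pos m - int j" "\<lambda>z'. nat (- coset_pos m - z')"])
        (auto simp: neg_points_def coset_pos_def pos_rep_def inversion_root_def elim!: evenE)
  next
    case False
    then show ?thesis
      by (intro prod.reindex_bij_witness[of _ "\<lambda>j. int j + 1 - coset_pos m" "\<lambda>z'. nat (coset_pos m + z' - 1)"])
        (auto simp: neg_points_def coset_pos_def pos_rep_def inversion_root_def algebra_simps elim!: oddE)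
  qed
  also have "\<dots> = (- 1) ^ m * char_S h (coset_word m)"
    by (simp add: char_S_coset_word prod_uminus)
  finally show ?thesis .
qed

lemma fixed_pt_term_pos_rep:
  fixes h :: "root \<Rightarrow> 'a::field"
  assumes h: "lattice_char h" and mn: "m \<le> n"
  defines "z \<equiv> coset_pos m" and "q \<equiv> h (1, 1)"
  shows "fixed_pt_term h (label_lo n) (label_hi n) z * ((\<Prod>z'\<in>{label_lo n..label_hi n}. 1 - h (pos_rep (- z - z')))
       * qfac q (nat (z - label_lo n)) * qfac q (nat (label_hi n - z)))
     = (- 1) ^ m * char_S h (coset_word m) * (1 - h (coset_rep m (simple_root I1))) * qfac q n"
proof -
  define C where "C = (\<Prod>z'\<in>{label_lo n..label_hi n} - {z}. 1 - h (curve_weight z z'))"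
  have zin: "z \<in> {label_lo n..label_hi n}" using coset_pos_mem[of n m] mn by (simp add: z_def)
  have q0: "qfac q k \<noteq> 0" for k using qfac_nonzero[OF h] by (simp add: q_def)
  have C0: "C \<noteq> 0"
    using lattice_char_eq_1_iff[OF h] curve_weight_nonzero by (auto simp: C_def)
  have len: "nat (label_hi n - label_lo n) = n" by (simp add: label_hi_def label_lo_def)
  \<comment> \<open>With x = e^\<beta> for the positive root \<beta>, this is 1 - x = (1 -
    x^-1)(-x).\<close>
  have factor: "1 - h (pos_rep (- z - z')) = (1 - h (curve_weight z z')) *
      (if z' \<in> neg_points m then - h (pos_rep (- z - z')) else 1)" if "z' \<noteq> z" for z'
  proof (cases "z' \<in> neg_points m")
    case True
    then have "curve_weight z z' = - pos_rep (- z - z')"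
      using that curve_weight_pos_rep[of z' m] by (simp add: z_def)
    then show ?thesis
      using True lattice_char_uminus[OF h, of "pos_rep (- z - z')"] by (simp add: algebra_simps)
  next
    case False
    then show ?thesis
      using that curve_weight_pos_rep[of z' m] by (simp add: z_def)
  qed
  have "(\<Prod>z'\<in>{label_lo n..label_hi n} - {z}. if z' \<in> neg_points m then - h (pos_rep (- z - z')) else 1)
      = (\<Prod>z'\<in>neg_points m. - h (pos_rep (- z - z')))"
    using neg_points_subset[OF mn] by (intro prod.mono_neutral_cong_right) (auto simp: z_def)
  moreover have "(\<Prod>z'\<in>{label_lo n..label_hi n} - {z}. 1 - h (pos_rep (- z - z')))
      = C * (\<Prod>z'\<in>{label_lo n..label_hi n} - {z}. if z' \<in> neg_points m then - h (pos_rep (- z - z')) else 1)"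
    unfolding C_def prod.distrib[symmetric] by (rule prod.cong) (auto simp: factor)
  ultimately have "(\<Prod>z'\<in>{label_lo n..label_hi n} - {z}. 1 - h (pos_rep (- z - z')))
      = C * ((- 1) ^ m * char_S h (coset_word m))"
    using prod_neg_points[of h m] by (simp only: z_def)
  moreover have "pos_rep (- z - z) = coset_rep m (simple_root I1)"
    by (simp add: coset_rep_simple_root z_def del: simple_root.simps)
  ultimately have "(\<Prod>z'\<in>{label_lo n..label_hi n}. 1 - h (pos_rep (- z - z')))
      = (1 - h (coset_rep m (simple_root I1))) * (C * ((- 1) ^ m * char_S h (coset_word m)))"
    using zin by (simp add: prod.remove)
  moreover have "fixed_pt_term h (label_lo n) (label_hi n) z
      = qfac q n / (qfac q (nat (z - label_lo n)) * qfac q (nat (label_hi n - z)) * C)"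
    using zin by (simp add: fixed_pt_term_def q_def C_def len)
  ultimately show ?thesis
    using q0 C0 by simp
qed

section \<open>Expansion in power series\<close>

definition emonom :: "nat \<Rightarrow> nat \<Rightarrow> int poly poly" where
  "emonom a b = monom (monom 1 a) b"

lemma emonom_mult: "emonom a b * emonom c d = emonom (a + c) (b + d)"
  by (simp add: emonom_def mult_monom)

lemma expo_of_nat: "expo (int a, int b) = Fract (emonom a b) 1"
proof -
  have pw: "Fract p 1 ^ k = Fract (p ^ k) 1" for p :: "int poly poly" and k
    by (induction k) (simp_all add: One_fract_def)
  have x: "([:[:0, 1:]:] :: int poly poly) ^ a = emonom a 0"
    by (simp add: emonom_def monom_0 poly_const_pow monom_altdef)
  have y: "([:0, 1:] :: int poly poly) ^ b = emonom 0 b"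
    by (simp add: emonom_def monom_altdef pCons_one)
  show ?thesis by (simp add: expo_def pw x y emonom_mult)
qed

lemma expo_add: "expo (\<beta> + \<gamma>) = expo \<beta> * expo \<gamma>"
proof -
  have "Fract [:[:0, 1:]:] 1 \<noteq> (0 :: ratfun)" "Fract [:0, 1:] 1 \<noteq> (0 :: ratfun)"
    by (simp_all add: Zero_fract_def eq_fract)
  then show ?thesis by (simp add: expo_def power_int_add)
qed

lemma emonom_inject: "emonom a b = emonom c d \<longleftrightarrow> a = c \<and> b = d"
proof
  assume e: "emonom a b = emonom c d"
  have "coeff (coeff (emonom a b) b) a = 1" by (simp add: emonom_def)
  then have "coeff (coeff (emonom c d) b) a = 1" using e by simp
  then show "a = c \<and> b = d" by (auto simp: emonom_def split: if_splits)
qed simp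

lemma lattice_char_expo: "lattice_char expo"
  unfolding lattice_char_def
proof (intro conjI allI)
  show "expo (\<beta> + \<gamma>) = expo \<beta> * expo \<gamma>" for \<beta> \<gamma> by (rule expo_add)
  show "expo \<beta> = 1 \<longleftrightarrow> \<beta> = 0" for \<beta>
  proof
    assume 1: "expo \<beta> = 1"
    obtain a b where ab: "\<beta> = (a, b)" by (cases \<beta>)
    \<comment> \<open>Moving the negative parts of the exponents to the other side leaves monomials
      of polynomials, which can be compared.\<close>
    have "expo (int (nat a), int (nat b)) = expo (\<beta> + (int (nat (- a)), int (nat (- b))))"
      by (simp add: ab)
    also have "\<dots> = expo (int (nat (- a)), int (nat (- b)))"
      by (simp only: expo_add 1 mult_1)
    finally have "nat a = nat (- a) \<and> nat b = nat (- b)"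
      by (simp only: expo_of_nat eq_fract emonom_inject mult_1_right one_neq_zero not_False_eq_True)
    then show "\<beta> = 0" by (auto simp: ab zero_prod_def)
  qed (simp add: expo_def)
qed

lemma loc_R_formula:
  assumes "m \<le> n"
  shows "loc_R m n * ((\<Prod>z'\<in>{label_lo n..label_hi n}. 1 - expo (pos_rep (- coset_pos m - z')))
       * qfac (expo (1, 1)) (nat (coset_pos m - label_lo n)) * qfac (expo (1, 1)) (nat (label_hi n - coset_pos m)))
     = (- 1) ^ m * S_coset m * (1 - expo (coset_rep m (simple_root I1))) * qfac (expo (1, 1)) n"
proof -
  have "S_coset m = char_S expo (coset_word m)"
    by (simp add: S_coset_def S_word_def char_S_def)
  then show ?thesis
    using fixed_pt_term_pos_rep[OF lattice_char_expo assms]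
    by (simp only: loc_R_eq coset_sum_coset_word[OF lattice_char_expo])
qed

lemma loc_R_eq_0:
  assumes "n < m"
  shows "loc_R m n = 0"
  using assms coset_pos_mem[of n m]
  by (auto simp: loc_R_eq coset_sum_coset_word[OF lattice_char_expo] fixed_pt_term_def)

section \<open>Monomial series and the arithmetic of expansions\<close>

definition smonom :: "nat \<Rightarrow> nat \<Rightarrow> series" where
  "smonom a b = fps_const (fps_X ^ a) * fps_X ^ b"

lemma smonom_mult_nth:
  "(smonom a b * F) $ j $ i = (if b \<le> j \<and> a \<le> i then F $ (j - b) $ (i - a) else 0)"
  by (simp add: smonom_def mult.assoc fps_X_power_mult_nth)

lemma smonom_nth: "smonom a b $ j $ i = (if j = b \<and> i = a then 1 else 0)"
  by (simp add: smonom_def fps_X_power_iff)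

lemma smonom_mult: "smonom a b * smonom c d = smonom (a + c) (b + d)"
  by (simp add: smonom_def power_add fps_const_mult[symmetric] ac_simps del: fps_const_mult)

lemma smonom_0_0 [simp]: "smonom 0 0 = 1"
  by (simp add: smonom_def)

lemma poly_series_nth: "poly_series p $ j $ i = coeff (coeff p j) i"
  by (simp add: poly_series_def coeff_map_poly)

lemma poly_series_1: "poly_series 1 = 1"
  by (simp add: poly_series_def)

lemma poly_series_diff: "poly_series (p - q) = poly_series p - poly_series q"
  by (intro fps_ext) (simp add: poly_series_nth)

lemma poly_series_emonom: "poly_series (emonom a b) = smonom a b"
  by (intro fps_ext) (auto simp: poly_series_nth emonom_def smonom_nth)

lemma expands_to_poly: "expands_to (Fract p 1) (poly_series p)"
  unfolding expands_to_def by (rule exI[of _ p], rule exI[of _ 1]) (simp add: poly_series_1)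

lemma expands_to_0: "expands_to 0 0"
  unfolding expands_to_def
  by (rule exI[of _ 0], rule exI[of _ 1]) (simp add: Zero_fract_def poly_series_def)

lemma expands_to_1: "expands_to 1 1"
  using expands_to_poly[of 1] by (simp add: poly_series_1 One_fract_def)

lemma expands_to_mult:
  assumes "expands_to r f" "expands_to s g"
  shows "expands_to (r * s) (f * g)"
proof -
  obtain p q where 1: "q \<noteq> 0" "r = Fract p q" "poly_series q * f = poly_series p"
    using assms(1) unfolding expands_to_def by blast
  obtain p' q' where 2: "q' \<noteq> 0" "s = Fract p' q'" "poly_series q' * g = poly_series p'"
    using assms(2) unfolding expands_to_def by blast
  have "poly_series (q * q') * (f * g) = poly_series (p * p')"
    by (simp add: poly_series_mult 1(3)[symmetric] 2(3)[symmetric] ac_simps)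
  then show ?thesis
    unfolding expands_to_def using 1 2
    by (intro exI[of _ "p * p'"] exI[of _ "q * q'"]) simp
qed

lemma expands_to_prod:
  "(\<And>x. x \<in> A \<Longrightarrow> expands_to (r x) (f x)) \<Longrightarrow> expands_to (prod r A) (prod f A)"
  by (induction A rule: infinite_finite_induct) (auto intro: expands_to_mult expands_to_1)

text \<open>The equation \<open>D * F = N\<close> replaces a division of series;
  \<open>d \<noteq> 0\<close> lets the numerator of \<open>d\<close> serve as a denominator.\<close>

lemma expands_to_divide:
  assumes "expands_to n N" "expands_to d D" "d \<noteq> 0" "D * F = N"
  shows "expands_to (n / d) F"
proof -
  obtain p q where 1: "q \<noteq> 0" "n = Fract p q" "poly_series q * N = poly_series p"
    using assms(1) unfolding expands_to_def by blast
  obtain p' q' where 2: "q' \<noteq> 0" "d = Fract p' q'" "poly_series q' * D = poly_series p'"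
    using assms(2) unfolding expands_to_def by blast
  have "p' \<noteq> 0" using 2 \<open>d \<noteq> 0\<close> by (auto simp: fract_collapse)
  moreover have "poly_series (q * p') * F = poly_series (p * q')"
    unfolding poly_series_mult 1(3)[symmetric] 2(3)[symmetric] assms(4)[symmetric] by (simp only: ac_simps)
  ultimately show ?thesis
    unfolding expands_to_def using 1(1) 2(1)
    by (intro exI[of _ "p * q'"] exI[of _ "q * p'"]) (simp add: 1(2) 2(2))
qed

lemma expands_to_minus_1_power: "expands_to ((- 1) ^ m) ((- 1) ^ m)"
proof (cases "even m")
  case True
  then show ?thesis by (simp add: expands_to_1)
next
  case False
  have "expands_to (Fract (0 - 1) 1) (poly_series (0 - 1))" by (rule expands_to_poly)
  moreover have "Fract (0 - 1) 1 = (- 1 :: ratfun)" by (simp add: One_fract_def)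
  moreover have "poly_series (0 - 1) = - 1" by (simp only: poly_series_diff poly_series_1) (simp add: poly_series_def)
  ultimately show ?thesis using False by simp
qed

lemma expands_to_expo: "expands_to (expo (int a, int b)) (smonom a b)"
  unfolding expo_of_nat poly_series_emonom[symmetric] by (rule expands_to_poly)

lemma expands_to_1_minus_expo: "expands_to (1 - expo (int a, int b)) (1 - smonom a b)"
proof -
  have "1 - expo (int a, int b) = Fract (1 - emonom a b) 1"
    by (simp add: expo_of_nat One_fract_def)
  moreover have "1 - smonom a b = poly_series (1 - emonom a b)"
    by (simp add: poly_series_diff poly_series_1 poly_series_emonom)
  ultimately show ?thesis by (simp only: expands_to_poly)
qed

lemma expansion_eqI: "expands_to r f \<Longrightarrow> expansion r = f"
  unfolding expansion_def by (blast intro: expands_to_unique)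

section \<open>Coefficientwise limits\<close>

text \<open>Congruence modulo the ideal of series without terms of total degree at most N, hence
  compatible with products.\<close>

definition eq_upto :: "nat \<Rightarrow> series \<Rightarrow> series \<Rightarrow> bool" where
  "eq_upto N F G \<longleftrightarrow> (\<forall>i j. i + j \<le> N \<longrightarrow> F $ j $ i = G $ j $ i)"

lemma eq_upto_refl [simp]: "eq_upto N F F"
  by (simp add: eq_upto_def)

lemma eq_upto_trans: "eq_upto N F G \<Longrightarrow> eq_upto N G H \<Longrightarrow> eq_upto N F H"
  by (simp add: eq_upto_def)

lemma eq_upto_mono: "eq_upto N F G \<Longrightarrow> N' \<le> N \<Longrightarrow> eq_upto N' F G"
  by (simp add: eq_upto_def)

lemma eq_upto_sym: "eq_upto N F G \<Longrightarrow> eq_upto N G F"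
  by (simp add: eq_upto_def)

lemma eq_upto_mult:
  assumes "eq_upto N F F'" "eq_upto N G G'"
  shows "eq_upto N (F * G) (F' * G')"
  unfolding eq_upto_def
proof (intro allI impI)
  fix i j assume "i + j \<le> N"
  then show "(F * G) $ j $ i = (F' * G') $ j $ i"
    unfolding fps_mult_nth fps_sum_nth
    using assms by (intro sum.cong refl arg_cong2[of _ _ _ _ "(*)"]) (auto simp: eq_upto_def)
qed

lemma eq_upto_prod:
  "(\<And>x. x \<in> A \<Longrightarrow> eq_upto N (f x) (g x)) \<Longrightarrow> eq_upto N (prod f A) (prod g A)"
  by (induction A rule: infinite_finite_induct) (auto intro: eq_upto_mult)

text \<open>The integers are discrete, so a converging coefficient is eventually constant, and only
  finitely many coefficients have total degree at most N.\<close>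

lemma coeffwise_tendsto_iff:
  "coeffwise_tendsto F L net \<longleftrightarrow> (\<forall>N. eventually (\<lambda>x. eq_upto N (F x) L) net)"
proof
  assume L: "coeffwise_tendsto F L net"
  show "\<forall>N. eventually (\<lambda>x. eq_upto N (F x) L) net"
  proof
    fix N
    have "eventually (\<lambda>x. F x $ j $ i = L $ j $ i) net" for i j
      using L by (simp add: coeffwise_tendsto_def tendsto_discrete)
    then have "eventually (\<lambda>x. \<forall>i\<in>{..N}. \<forall>j\<in>{..N}. F x $ j $ i = L $ j $ i) net"
      by (simp add: eventually_ball_finite_distrib)
    then show "eventually (\<lambda>x. eq_upto N (F x) L) net"
      by eventually_elim (auto simp: eq_upto_def)
  qed
next
  assume L: "\<forall>N. eventually (\<lambda>x. eq_upto N (F x) L) net"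
  show "coeffwise_tendsto F L net"
    unfolding coeffwise_tendsto_def tendsto_discrete
  proof (intro allI)
    fix i j
    from L have "eventually (\<lambda>x. eq_upto (i + j) (F x) L) net" by blast
    then show "eventually (\<lambda>x. F x $ j $ i = L $ j $ i) net"
      by eventually_elim (simp add: eq_upto_def)
  qed
qed

lemma coeffwise_tendsto_const: "coeffwise_tendsto (\<lambda>x. F) F net"
  by (simp add: coeffwise_tendsto_iff)

lemma coeffwise_tendsto_mult:
  assumes "coeffwise_tendsto F L net" "coeffwise_tendsto G M net"
  shows "coeffwise_tendsto (\<lambda>x. F x * G x) (L * M) net"
  unfolding coeffwise_tendsto_iff
proof
  fix N
  have "eventually (\<lambda>x. eq_upto N (F x) L) net" "eventually (\<lambda>x. eq_upto N (G x) M) net"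
    using assms by (auto simp: coeffwise_tendsto_iff)
  then show "eventually (\<lambda>x. eq_upto N (F x * G x) (L * M)) net"
    by eventually_elim (rule eq_upto_mult)
qed

lemma coeffwise_tendsto_compose:
  "coeffwise_tendsto F L net \<Longrightarrow> filterlim g net net' \<Longrightarrow> coeffwise_tendsto (\<lambda>x. F (g x)) L net'"
  unfolding coeffwise_tendsto_iff
  by (intro allI, rule eventually_compose_filterlim[where f = g and F = net]) auto

lemma coeffwise_tendsto_cong_eventually:
  assumes "coeffwise_tendsto F L net" "eventually (\<lambda>x. F x = G x) net"
  shows "coeffwise_tendsto G L net"
  unfolding coeffwise_tendsto_iff
proof
  fix N
  have "eventually (\<lambda>x. eq_upto N (F x) L) net" using assms by (auto simp: coeffwise_tendsto_iff)
  with assms(2) show "eventually (\<lambda>x. eq_upto N (G x) L) net" by eventually_elim simp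
qed

text \<open>Since \<open>U - V = U V (L - D)\<close>, agreement of \<open>D\<close> with \<open>L\<close> up to total degree \<open>N\<close> passes to the
  inverses.\<close>

lemma coeffwise_tendsto_inverse:
  fixes D :: "'a \<Rightarrow> series"
  assumes "coeffwise_tendsto D L net" "\<And>x. D x * U x = 1" "L * V = 1"
  shows "coeffwise_tendsto U V net"
  unfolding coeffwise_tendsto_iff
proof
  fix N
  have "eventually (\<lambda>x. eq_upto N (D x) L) net" using assms(1) by (auto simp: coeffwise_tendsto_iff)
  then show "eventually (\<lambda>x. eq_upto N (U x) V) net"
  proof eventually_elim
    case (elim x)
    then have "eq_upto N ((U x * V) * L) ((U x * V) * D x)"
      by (intro eq_upto_mult eq_upto_refl) (rule eq_upto_sym)
    moreover have "(U x * V) * L = U x * (L * V)" "(U x * V) * D x = (D x * U x) * V"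
      by (simp_all only: ac_simps)
    ultimately show ?case using assms(2,3) by simp
  qed
qed

section \<open>Units and the infinite product over the positive real roots\<close>

lemma fps_unit_right_inverse:
  fixes f :: "'a::comm_ring_1 fps"
  assumes "f $ 0 * c = 1"
  obtains g where "f * g = 1"
  using fps_right_inverse[of f c] assms by blast

text \<open>Invert twice: first the constant coefficient as a series in e^\<alpha>_0, then the whole
  series in e^\<alpha>_1.\<close>

lemma series_unit_right_inverse:
  fixes F :: series
  assumes "F $ 0 $ 0 = 1"
  obtains G where "F * G = 1"
proof -
  obtain c where "F $ 0 * c = 1" using assms fps_unit_right_inverse[of "F $ 0" 1] by auto
  then show ?thesis using that by (rule fps_unit_right_inverse)
qed

text \<open>Used for positive roots, whose coordinates are nonnegative, so \<open>nat\<close> loses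
  nothing.\<close>

definition root_factor :: "root \<Rightarrow> series" where
  "root_factor \<alpha> = 1 - smonom (nat (fst \<alpha>)) (nat (snd \<alpha>))"

lemma pos_real_roots_eq: "pos_real_roots = range pos_rep"
proof (intro equalityI subsetI)
  fix \<alpha> assume "\<alpha> \<in> pos_real_roots"
  then consider "\<alpha> = (0, 1)" | n where "n \<ge> 1" "\<alpha> = (int n, int n + 1)"
    | n where "n \<ge> 1" "\<alpha> = (int n, int n - 1)"
    by (auto simp: pos_real_roots_def root_scale_def null_root_def)
  then show "\<alpha> \<in> range pos_rep"
  proof cases
    case 1
    then show ?thesis by (intro image_eqI[of _ _ 0]) (auto simp: pos_rep_def)
  next
    case 2
    then show ?thesis by (intro image_eqI[of _ _ "int n"]) (auto simp: pos_rep_def)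
  next
    case 3
    then show ?thesis by (intro image_eqI[of _ _ "- int n"]) (auto simp: pos_rep_def)
  qed
next
  fix \<alpha> assume "\<alpha> \<in> range pos_rep"
  then obtain k where k: "\<alpha> = pos_rep k" by blast
  show "\<alpha> \<in> pos_real_roots"
  proof (cases "k \<ge> 0")
    case True
    then have "\<alpha> = simple_root I1 + root_scale (int (nat k)) null_root" "k = 0 \<or> nat k \<ge> 1"
      by (auto simp: k pos_rep_def root_scale_def null_root_def)
    then show ?thesis
      unfolding pos_real_roots_def by (auto simp: root_scale_def)
  next
    case False
    then have "\<alpha> = - simple_root I1 + root_scale (int (nat (- k))) null_root" "nat (- k) \<ge> 1"
      by (auto simp: k pos_rep_def root_scale_def null_root_def)
    then show ?thesis
      unfolding pos_real_roots_def by blast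
  qed
qed

lemma inj_pos_rep: "inj pos_rep"
  by (auto simp: inj_on_def pos_rep_def split: if_splits)

lemma expands_to_root_factor: "expands_to (1 - expo (pos_rep k)) (root_factor (pos_rep k))"
proof -
  have "pos_rep k = (int (nat (fst (pos_rep k))), int (nat (snd (pos_rep k))))"
    by (simp add: pos_rep_def)
  then show ?thesis unfolding root_factor_def by (metis expands_to_1_minus_expo)
qed

lemma smonom_eq_upto_0: "N < a + b \<Longrightarrow> eq_upto N (1 - smonom a b) 1"
  by (auto simp: eq_upto_def smonom_nth)

lemma prod_nth_0_0: "(\<Prod>x\<in>A. f x) $ 0 $ 0 = (\<Prod>x\<in>A. (f x :: series) $ 0 $ 0)"
  by (induction A rule: infinite_finite_induct) (simp_all add: fps_mult_nth)

lemma root_factor_nth_0_0: "root_factor (pos_rep k) $ 0 $ 0 = 1"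
  by (auto simp: root_factor_def smonom_nth pos_rep_def)

text \<open>Up to degree N only the finitely many factors in \<open>E N\<close> matter, so a
  coefficient of degree i + j can be read off from the product over
  \<open>E (i + j)\<close>.\<close>

lemma coeffwise_tendsto_prodI:
  fixes f :: "'a \<Rightarrow> series"
  assumes fin: "\<And>N. finite {a \<in> A. \<not> eq_upto N (f a) 1}"
  obtains L where "coeffwise_tendsto (\<lambda>B. \<Prod>a\<in>B. f a) L (finite_subsets_at_top A)"
proof -
  define E where "E N = {a \<in> A. \<not> eq_upto N (f a) 1}" for N
  define L where "L = Abs_fps (\<lambda>j. Abs_fps (\<lambda>i. prod f (E (i + j)) $ j $ i))"
  have up: "eq_upto N (prod f B) (prod f (E N))" if "finite B" "E N \<subseteq> B" "B \<subseteq> A" for B N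
  proof -
    have "eq_upto N (prod f (B - E N)) (prod (\<lambda>_. 1) (B - E N))"
      using that by (intro eq_upto_prod) (auto simp: E_def)
    then have "eq_upto N (prod f (B - E N) * prod f (E N)) (1 * prod f (E N))"
      by (intro eq_upto_mult) simp_all
    moreover have "prod f B = prod f (B - E N) * prod f (E N)"
      using that by (intro prod.subset_diff) auto
    ultimately show ?thesis by simp
  qed
  have mono: "E (i + j) \<subseteq> E N" if "i + j \<le> N" for i j N
    unfolding E_def using that eq_upto_mono by blast
  have finE: "finite (E N)" and subE: "E N \<subseteq> A" for N
    using fin[of N] by (simp_all add: E_def)
  have EL: "eq_upto N (prod f (E N)) L" for N
    unfolding eq_upto_def
  proof (intro allI impI)
    fix i j assume ij: "i + j \<le> N"
    have "eq_upto (i + j) (prod f (E N)) (prod f (E (i + j)))"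
      by (rule up[OF finE mono[OF ij] subE])
    then have "prod f (E N) $ j $ i = prod f (E (i + j)) $ j $ i"
      unfolding eq_upto_def by blast
    then show "prod f (E N) $ j $ i = L $ j $ i" by (simp only: L_def fps_nth_Abs_fps)
  qed
  have "eventually (\<lambda>B. eq_upto N (prod f B) L) (finite_subsets_at_top A)" for N
    unfolding eventually_finite_subsets_at_top
  proof (intro exI[of _ "E N"] conjI allI impI finE subE)
    fix B assume "finite B \<and> E N \<subseteq> B \<and> B \<subseteq> A"
    then show "eq_upto N (prod f B) L" by (blast intro: eq_upto_trans[OF up EL])
  qed
  then have "coeffwise_tendsto (\<lambda>B. \<Prod>a\<in>B. f a) L (finite_subsets_at_top A)"
    by (simp add: coeffwise_tendsto_iff)
  then show ?thesis by (rule that)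
qed

definition real_root_product :: series where
  "real_root_product = series_infprod (\<lambda>\<alpha>. expansion (1 - expo \<alpha>)) pos_real_roots"

lemma real_root_product_tendsto:
  "coeffwise_tendsto (\<lambda>B. \<Prod>\<alpha>\<in>B. root_factor \<alpha>) real_root_product
     (finite_subsets_at_top pos_real_roots)"
proof -
  have "finite {\<alpha> \<in> pos_real_roots. \<not> eq_upto N (root_factor \<alpha>) 1}" for N
  proof (rule finite_subset)
    \<comment> \<open>The height of \<open>pos_rep k\<close> is 2k + 1 or -2k - 1, which exceeds N
      for such k.\<close>
    have "eq_upto N (root_factor (pos_rep k)) 1" if "k \<notin> {- int N..int N}" for k
      unfolding root_factor_def using that by (intro smonom_eq_upto_0) (auto simp: pos_rep_def)
    then show "{\<alpha> \<in> pos_real_roots. \<not> eq_upto N (root_factor \<alpha>) 1} \<subseteq> pos_rep ` {- int N..int N}"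
      unfolding pos_real_roots_eq by blast
  qed simp
  then obtain L where L: "coeffwise_tendsto (\<lambda>B. \<Prod>\<alpha>\<in>B. root_factor \<alpha>) L
      (finite_subsets_at_top pos_real_roots)"
    by (rule coeffwise_tendsto_prodI)
  have "eventually (\<lambda>B. (\<Prod>\<alpha>\<in>B. root_factor \<alpha>) = (\<Prod>\<alpha>\<in>B. expansion (1 - expo \<alpha>)))
      (finite_subsets_at_top pos_real_roots)"
  proof (rule eventually_finite_subsets_at_top_weakI)
    fix B assume "B \<subseteq> pos_real_roots"
    then have "expansion (1 - expo \<alpha>) = root_factor \<alpha>" if "\<alpha> \<in> B" for \<alpha>
      using that expansion_eqI[OF expands_to_root_factor] by (auto simp: pos_real_roots_eq)
    then show "(\<Prod>\<alpha>\<in>B. root_factor \<alpha>) = (\<Prod>\<alpha>\<in>B. expansion (1 - expo \<alpha>))"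
      by simp
  qed
  with L have L': "coeffwise_tendsto (\<lambda>B. \<Prod>\<alpha>\<in>B. expansion (1 - expo \<alpha>)) L
      (finite_subsets_at_top pos_real_roots)"
    by (rule coeffwise_tendsto_cong_eventually)
  then have "real_root_product = L"
    unfolding real_root_product_def series_infprod_def
    by (intro the_equality) (auto intro: coeffwise_tendsto_unique[OF finite_subsets_at_top_neq_bot])
  with L show ?thesis by simp
qed

text \<open>The growing intervals, carried injectively to roots, eventually contain every finite set
  of positive real roots, so the limit along finite subsets applies.\<close>

lemma interval_product_tendsto:
  "coeffwise_tendsto (\<lambda>n. \<Prod>z'\<in>{label_lo n..label_hi n}. root_factor (pos_rep (- coset_pos m - z')))
     real_root_product sequentially"
proof -
  let ?A = "\<lambda>n. (\<lambda>z'. pos_rep (- coset_pos m - z')) ` {label_lo n..label_hi n}"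
  have "filterlim ?A (finite_subsets_at_top pos_real_roots) sequentially"
    unfolding filterlim_finite_subsets_at_top
  proof (intro allI impI)
    fix X assume X: "finite X \<and> X \<subseteq> pos_real_roots"
    then obtain K where K: "finite K" "X = pos_rep ` K"
      unfolding pos_real_roots_eq by (meson finite_subset_image)
    define M where "M = Max (insert 0 ((\<lambda>k. nat \<bar>- coset_pos m - k\<bar>) ` K))"
    have "X \<subseteq> ?A n" if n: "n \<ge> 2 * M" for n
    proof
      fix \<alpha> assume "\<alpha> \<in> X"
      then obtain k where k: "k \<in> K" "\<alpha> = pos_rep k" using K by blast
      then have "nat \<bar>- coset_pos m - k\<bar> \<le> M" unfolding M_def using K(1) by (intro Max_ge) auto
      then have "- coset_pos m - k \<in> {label_lo n..label_hi n}" using n by (auto simp: label_lo_def label_hi_def)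
      then show "\<alpha> \<in> ?A n" by (rule rev_image_eqI) (simp add: k)
    qed
    then show "eventually (\<lambda>n. finite (?A n) \<and> X \<subseteq> ?A n \<and> ?A n \<subseteq> pos_real_roots) sequentially"
      by (intro eventually_sequentiallyI[of "2 * M"]) (auto simp: pos_real_roots_eq)
  qed
  from coeffwise_tendsto_compose[OF real_root_product_tendsto this]
  show ?thesis
    by (subst (asm) prod.reindex) (auto simp: o_def inj_on_def dest: injD[OF inj_pos_rep])
qed

section \<open>The partition series\<close>

definition bounded_partitions :: "nat \<Rightarrow> nat \<Rightarrow> nat multiset set" where
  "bounded_partitions n k = {M. set_mset M \<subseteq> {1..n} \<and> sum_mset M = k}"

lemma member_le_sum_mset: "x \<in># M \<Longrightarrow> (x::nat) \<le> sum_mset M"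
proof -
  assume "x \<in># M"
  then obtain M' where "M = add_mset x M'" by (meson multi_member_split)
  then show ?thesis by simp
qed

lemma finite_bounded_partitions: "finite (bounded_partitions n k)"
proof (rule finite_subset)
  show "bounded_partitions n k \<subseteq> (\<Union>s\<in>{..k}. multisets_of_size {1..n} s)"
  proof
    fix M assume M: "M \<in> bounded_partitions n k"
    have "size M \<le> sum_mset M" if "0 \<notin># M" for M :: "nat multiset"
      using that by (induction M) auto
    then show "M \<in> (\<Union>s\<in>{..k}. multisets_of_size {1..n} s)"
      using M by (force simp: bounded_partitions_def multisets_of_size_def)
  qed
  show "finite (\<Union>s\<in>{..k}. multisets_of_size {1..n} s)"
    by (intro finite_UN_I finite_atMost finite_multisets_of_size finite_atLeastAtMost)
qed

lemma card_bounded_partitions_0: "card (bounded_partitions 0 k) = (if k = 0 then 1 else 0)"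
proof -
  have "bounded_partitions 0 k = (if k = 0 then {{#}} else {})"
    by (auto simp: bounded_partitions_def)
  then show ?thesis by simp
qed

text \<open>Either \<open>Suc n\<close> is not a part, or one copy of it can be removed.\<close>

lemma card_bounded_partitions_Suc:
  "card (bounded_partitions (Suc n) k) = card (bounded_partitions n k)
     + (if Suc n \<le> k then card (bounded_partitions (Suc n) (k - Suc n)) else 0)"
proof -
  let ?add = "add_mset (Suc n)"
  let ?B = "if Suc n \<le> k then ?add ` bounded_partitions (Suc n) (k - Suc n) else {}"
  have un: "bounded_partitions (Suc n) k = bounded_partitions n k \<union> ?B"
  proof (intro equalityI subsetI)
    fix M assume M: "M \<in> bounded_partitions (Suc n) k"
    show "M \<in> bounded_partitions n k \<union> ?B"
    proof (cases "Suc n \<in># M")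
      case True
      then obtain M' where M': "M = ?add M'" by (meson multi_member_split)
      then have "M' \<in> bounded_partitions (Suc n) (k - Suc n)" "Suc n \<le> k"
        using M by (auto simp: bounded_partitions_def)
      then show ?thesis by (simp add: M')
    next
      case False
      then have "set_mset M \<subseteq> {1..n}"
        using M unfolding bounded_partitions_def by (force simp: le_Suc_eq)
      then show ?thesis using M by (simp add: bounded_partitions_def)
    qed
  next
    fix M assume "M \<in> bounded_partitions n k \<union> ?B"
    then consider "M \<in> bounded_partitions n k"
      | M' where "Suc n \<le> k" "M = ?add M'" "M' \<in> bounded_partitions (Suc n) (k - Suc n)"
      by (auto split: if_splits)
    then show "M \<in> bounded_partitions (Suc n) k"
    proof cases
      case 1
      then show ?thesis unfolding bounded_partitions_def by fastforce
    next
      case 2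
      then show ?thesis by (simp add: bounded_partitions_def)
    qed
  qed
  have "Suc n \<notin># M" if "M \<in> bounded_partitions n k" for M
    using that unfolding bounded_partitions_def by fastforce
  moreover have "Suc n \<in># M" if "M \<in> ?B" for M
    using that by (auto split: if_splits)
  ultimately have "bounded_partitions n k \<inter> ?B = {}"
    by blast
  moreover have "card (?add ` S) = card S" for S
    by (simp add: card_image inj_on_def)
  ultimately show ?thesis
    unfolding un using finite_bounded_partitions by (simp add: card_Un_disjoint)
qed

lemma partition_number_eq:
  assumes "k \<le> n"
  shows "partition_number k = card (bounded_partitions n k)"
proof -
  have "0 \<notin># M \<longleftrightarrow> set_mset M \<subseteq> {1..n}" if "sum_mset M = k" for M
  proof
    assume "0 \<notin># M"
    show "set_mset M \<subseteq> {1..n}"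
    proof
      fix x assume "x \<in># M"
      then have "x \<noteq> 0" "x \<le> n"
        using \<open>0 \<notin># M\<close> member_le_sum_mset[of x M] that assms by (auto intro: ccontr)
      then show "x \<in> {1..n}" by simp
    qed
  qed auto
  then show ?thesis
    unfolding partition_number_def bounded_partitions_def by (metis (no_types, lifting))
qed

section \<open>Generating functions of partitions with bounded parts\<close>

definition bounded_partition_series :: "nat \<Rightarrow> series" where
  "bounded_partition_series n =
     Abs_fps (\<lambda>j. Abs_fps (\<lambda>i. if i = j then int (card (bounded_partitions n i)) else 0))"

lemma bounded_partition_series_Suc:
  "(1 - smonom (Suc n) (Suc n)) * bounded_partition_series (Suc n) = bounded_partition_series n"
  by (intro fps_ext)
    (auto simp: left_diff_distrib smonom_mult_nth bounded_partition_series_def card_bounded_partitions_Suc[of n])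

lemma smonom_power: "smonom 1 1 ^ n = smonom n n"
  by (induction n) (simp_all add: smonom_mult)

lemma qfac_bounded_partition_series: "qfac (smonom 1 1) n * bounded_partition_series n = 1"
proof (induction n)
  case 0
  show ?case
    by (intro fps_ext) (simp add: bounded_partition_series_def card_bounded_partitions_0 fps_one_nth)
next
  case (Suc n)
  have "qfac (smonom 1 1) (Suc n) * bounded_partition_series (Suc n)
      = qfac (smonom 1 1) n * ((1 - smonom (Suc n) (Suc n)) * bounded_partition_series (Suc n))"
    by (simp only: qfac_Suc smonom_power mult.assoc)
  then show ?case by (simp only: bounded_partition_series_Suc Suc)
qed

lemma bounded_partition_series_tendsto:
  "coeffwise_tendsto bounded_partition_series partition_series sequentially"
  unfolding coeffwise_tendsto_iff
proof
  fix N
  show "eventually (\<lambda>n. eq_upto N (bounded_partition_series n) partition_series) sequentially"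
  proof (rule eventually_sequentiallyI)
    fix n assume "N \<le> n"
    then show "eq_upto N (bounded_partition_series n) partition_series"
      by (auto simp: eq_upto_def bounded_partition_series_def partition_series_def
          partition_number_eq[where n = n])
  qed
qed


section \<open>The limit\<close>

text \<open>The constant term is inherited from a finite product agreeing with the limit in degree
  0; it makes the infinite product a unit.\<close>

lemma real_root_product_nth_0_0: "real_root_product $ 0 $ 0 = 1"
proof -
  obtain n where "eq_upto 0 (\<Prod>z'\<in>{label_lo n..label_hi n}. root_factor (pos_rep (- coset_pos 0 - z'))) real_root_product"
    using interval_product_tendsto[of 0] unfolding coeffwise_tendsto_iff eventually_sequentially by blast
  then show ?thesis
    by (simp add: eq_upto_def prod_nth_0_0 root_factor_nth_0_0)
qed

lemma partition_number_0: "partition_number 0 = 1"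
  by (simp add: partition_number_eq[of 0 0] card_bounded_partitions_0)

lemma expands_to_S_coset:
  obtains S where "expands_to (S_coset m) S"
proof -
  have "S_coset m = char_S expo (coset_word m)"
    by (simp add: S_coset_def S_word_def char_S_def)
  then have "S_coset m = (\<Prod>j<m. expo (inversion_root m j))"
    by (simp only: char_S_coset_word)
  moreover have "\<exists>f. expands_to (expo (inversion_root m j)) f" for j
    using expands_to_expo[of j "Suc j"] expands_to_expo[of "Suc j" j]
    by (auto simp: inversion_root_def add.commute)
  then obtain f where "\<And>j. expands_to (expo (inversion_root m j)) (f j)"
    by metis
  ultimately show ?thesis
    using that expands_to_prod[of "{..<m}"] by metis
qed

lemma expands_to_qfac: "expands_to (qfac (expo (1, 1)) n) (qfac (smonom 1 1) n)"
proof -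
  have "expo (1, 1) ^ i = expo (int i, int i)" for i
    by (rule lattice_char_null_multiple[OF lattice_char_expo, symmetric])
  then show ?thesis
    unfolding qfac_def by (intro expands_to_prod) (simp only: smonom_power expands_to_1_minus_expo)
qed

theorem theorem7p3:
  fixes m :: nat
  shows "has_series_limit (loc_R m)
     (series_quotient
        (expansion ((- 1) ^ m * S_coset m * (1 - expo (coset_rep m (simple_root I1))))
           * partition_series)
        (series_infprod (\<lambda>\<alpha>. expansion (1 - expo \<alpha>)) pos_real_roots))"
proof -
  let ?z = "coset_pos m"
  define c where "c = (- 1) ^ m * S_coset m * (1 - expo (coset_rep m (simple_root I1)))"
  define Pn where "Pn n = (\<Prod>z'\<in>{label_lo n..label_hi n}. root_factor (pos_rep (- ?z - z')))" for n
  define pn where "pn n = (\<Prod>z'\<in>{label_lo n..label_hi n}. 1 - expo (pos_rep (- ?z - z')))" for n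
  define k where "k n = nat (?z - label_lo n)" for n
  define l where "l n = nat (label_hi n - ?z)" for n
  define \<phi> where "\<phi> = qfac (smonom 1 1)"
  let ?Q = bounded_partition_series
  note \<phi>Q = qfac_bounded_partition_series[folded \<phi>_def]
  obtain C where C: "expands_to c C"
    using expands_to_S_coset[of m] expands_to_mult expands_to_minus_1_power[of m]
      expands_to_root_factor[of "- 2 * ?z"]
    unfolding c_def coset_rep_simple_root by metis
  \<comment> \<open>As \<open>\<phi> n * ?Q n = 1\<close>, the inverse \<open>U n\<close> is
    \<open>\<phi> n\<close> divided by \<open>Pn n\<close>, which includes the numerator of the
    Gaussian binomial coefficient.\<close>
  have "\<exists>U. (Pn n * ?Q n) * U = 1" for n
  proof -
    have "(Pn n * ?Q n) $ 0 $ 0 = 1"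
      by (simp add: fps_mult_nth Pn_def prod_nth_0_0 root_factor_nth_0_0 bounded_partition_series_def
          partition_number_eq[symmetric] partition_number_0)
    then show ?thesis by (metis series_unit_right_inverse)
  qed
  then obtain U where U: "\<And>n. (Pn n * ?Q n) * U n = 1" by metis
  have "(real_root_product * partition_series) $ 0 $ 0 = 1"
    by (simp add: fps_mult_nth real_root_product_nth_0_0 partition_series_def partition_number_0)
  then obtain V where V: "(real_root_product * partition_series) * V = 1"
    by (rule series_unit_right_inverse)
  \<comment> \<open>The closed form of \<open>loc_R m n\<close> with both denominators
    \<open>\<phi>\<close> replaced by their inverses \<open>?Q\<close>, so that every factor
    converges.\<close>
  define G where "G n = C * ?Q (k n) * ?Q (l n) * U n" for n
  define F where "F n = (if n < m then 0 else G n)" for n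
  \<comment> \<open>Both factors \<open>?Q\<close> tend to the partition series; \<open>V\<close>
    cancels one of them and divides by the product over the roots.\<close>
  define L where "L = C * partition_series * partition_series * V"

  have "coeffwise_tendsto U V sequentially"
    using coeffwise_tendsto_mult[OF interval_product_tendsto[of m, folded Pn_def]
        bounded_partition_series_tendsto] U V
    by (rule coeffwise_tendsto_inverse)
  moreover have "filterlim k sequentially sequentially" "filterlim l sequentially sequentially"
    unfolding filterlim_at_top
  proof (safe)
    \<comment> \<open>Up to rounding, \<open>k n\<close> and \<open>l n\<close> are n/2 shifted by
      \<open>?z\<close> or its negative, whence the threshold.\<close>
    fix N
    show "eventually (\<lambda>n. N \<le> k n) sequentially" "eventually (\<lambda>n. N \<le> l n) sequentially"
      by (rule eventually_sequentiallyI[of "2 * (N + nat \<bar>?z\<bar>)"],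
          simp add: k_def l_def label_lo_def label_hi_def)+
  qed
  then have "coeffwise_tendsto (\<lambda>n. ?Q (k n)) partition_series sequentially"
    "coeffwise_tendsto (\<lambda>n. ?Q (l n)) partition_series sequentially"
    using coeffwise_tendsto_compose[OF bounded_partition_series_tendsto] by blast+
  ultimately have "coeffwise_tendsto G L sequentially"
    unfolding G_def L_def by (intro coeffwise_tendsto_mult coeffwise_tendsto_const)
  then have lim: "coeffwise_tendsto F L sequentially"
    by (rule coeffwise_tendsto_cong_eventually)
      (auto simp: F_def intro: eventually_sequentiallyI[of m])

  have "expands_to (loc_R m n) (F n)" for n
  proof (cases "n < m")
    case True
    then show ?thesis by (simp add: F_def loc_R_eq_0 expands_to_0)
  next
    case False
    let ?q = "qfac (expo (1, 1))"
    let ?d = "pn n * ?q (k n) * ?q (l n)"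
    have "loc_R m n * ?d = c * ?q n"
      using loc_R_formula[of m n] False by (simp add: pn_def k_def l_def c_def)
    moreover have "?d \<noteq> 0"
    proof -
      have "expo (pos_rep j) \<noteq> 1" for j
        using lattice_char_eq_1_iff[OF lattice_char_expo, of "pos_rep j"]
        by (auto simp: pos_rep_def zero_prod_def)
      then show ?thesis
        using qfac_nonzero[OF lattice_char_expo] by (auto simp: pn_def)
    qed
    ultimately have "loc_R m n = (c * ?q n) / ?d"
      by (simp add: eq_divide_eq)
    moreover have "expands_to (c * ?q n) (C * \<phi> n)"
      unfolding \<phi>_def by (intro expands_to_mult C expands_to_qfac)
    moreover have "expands_to ?d (Pn n * \<phi> (k n) * \<phi> (l n))"
      unfolding \<phi>_def pn_def Pn_def
      by (intro expands_to_mult expands_to_prod expands_to_root_factor expands_to_qfac)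
    moreover have "(Pn n * \<phi> (k n) * \<phi> (l n)) * G n = C * \<phi> n"
    proof -
      have "(Pn n * \<phi> (k n) * \<phi> (l n)) * G n
          = C * (\<phi> (k n) * ?Q (k n)) * (\<phi> (l n) * ?Q (l n)) * (Pn n * U n)"
        by (simp only: G_def ac_simps)
      also have "\<dots> = C * (\<phi> n * ?Q n) * (Pn n * U n)" by (simp only: \<phi>Q mult_1_right)
      also have "\<dots> = C * \<phi> n * ((Pn n * ?Q n) * U n)" by (simp only: ac_simps)
      finally show ?thesis by (simp only: U mult_1_right)
    qed
    ultimately show ?thesis
      using False \<open>?d \<noteq> 0\<close> by (metis F_def expands_to_divide)
  qed
  with lim have "has_series_limit (loc_R m) L"
    unfolding has_series_limit_def by blast
  moreover have "series_quotient (expansion c * partition_series) real_root_product = L"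
  proof -
    have "L * real_root_product
        = C * partition_series * ((real_root_product * partition_series) * V)"
      by (simp only: L_def ac_simps)
    then have "L * real_root_product = expansion c * partition_series"
      by (simp only: V mult_1_right expansion_eqI[OF C])
    moreover have "real_root_product \<noteq> 0" using V by auto
    ultimately show ?thesis
      unfolding series_quotient_def by (intro the_equality) (auto intro: series_quotient_unique)
  qed
  ultimately show ?thesis
    by (simp only: real_root_product_def c_def)
qed

end
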